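(* Let $G$ be a (connected, simple) graph and let $G'$ be a connected minor graph of $G$ obtained from $G$ by removing and/or contracting a finite number of edges. Then $G$ is hyperbolic if and only if $G'$ is hyperbolic.
   Context: Graphs $G=(V,E)$ are connected, nonempty, possibly infinite, simple (no loops or multiple edges), and every edge has length $1$. $G$ is regarded as a geodesic metric space: each edge is identified isometrically with $[0,1]$, points of $G$ are the vertices together with all interior points of edges, and $d_G$ is the shortest-path distance. Hyperbolicity: a geodesic triangle $T=\{x_1,x_2,x_3\}$ in a geodesic metric space $X$ is the union of three geodesics $[x_1x_2],[x_2x_3],[x_3x_1]$ (the vertices may be arbitrary points of $X$, possibly coinciding). $T$ is $\delta$-thin if each side is contained in the $\delta$-neighborhood of the union of the other two sides. $X$ is $\delta$-hyperbolic if every geodesic triangle in $X$ is $\delta$-thin, and hyperbolic if it is $\delta$-hyperbolic for some $\delta\ge 0$. Edge contraction (simple graphs): for $e=[A,B]\in E(G)$, $G/e$ is the simple graph obtained by removing $e$ and merging $A$ and $B$ into a single vertex $V_e$; if both $[v,A]$ and $[v,B]$ are edges of $G$ for some vertex $v$, they are replaced by a single edge $[v,V_e]$ of $G/e$. Edge removal: $G\setminus e$ is the graph with $V(G\setminus e)=V(G)$ and $E(G\setminus e)=E(G)\setminus\{e\}$. *)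

theory Defs
  imports "HOL-Analysis.Abstract_Metric_Spaces"
begin

section \<open>Hyperbolic metric spaces\<close>

context Metric_space
begin

definition geodesic :: "'a \<Rightarrow> 'a \<Rightarrow> 'a set \<Rightarrow> bool" where
  "geodesic x y S \<longleftrightarrow> (\<exists>\<gamma>. \<gamma> \<in> {0..d x y} \<rightarrow> M \<and> \<gamma> 0 = x \<and> \<gamma> (d x y) = y \<and>
     (\<forall>s\<in>{0..d x y}. \<forall>t\<in>{0..d x y}. d (\<gamma> s) (\<gamma> t) = \<bar>s - t\<bar>) \<and> S = \<gamma> ` {0..d x y})"

definition nbhd :: "real \<Rightarrow> 'a set \<Rightarrow> 'a set" where
  "nbhd \<delta> S = {p \<in> M. \<exists>q\<in>S. d p q \<le> \<delta>}"

definition thin_triangle :: "real \<Rightarrow> 'a set \<Rightarrow> 'a set \<Rightarrow> 'a set \<Rightarrow> bool" where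
  "thin_triangle \<delta> S1 S2 S3 \<longleftrightarrow>
     S1 \<subseteq> nbhd \<delta> (S2 \<union> S3) \<and> S2 \<subseteq> nbhd \<delta> (S1 \<union> S3) \<and> S3 \<subseteq> nbhd \<delta> (S1 \<union> S2)"

definition hyperbolic_const :: "real \<Rightarrow> bool" where
  "hyperbolic_const \<delta> \<longleftrightarrow> (\<forall>x1\<in>M. \<forall>x2\<in>M. \<forall>x3\<in>M. \<forall>S1 S2 S3.
     geodesic x1 x2 S1 \<longrightarrow> geodesic x2 x3 S2 \<longrightarrow> geodesic x3 x1 S3 \<longrightarrow> thin_triangle \<delta> S1 S2 S3)"

definition hyperbolic :: bool where
  "hyperbolic \<longleftrightarrow> (\<exists>\<delta>\<ge>0. hyperbolic_const \<delta>)"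

end

section \<open>Simple graphs, possibly infinite\<close>

record 'a sgraph =
  verts :: "'a set"
  edges :: "'a set set"

definition simple_graph :: "'a sgraph \<Rightarrow> bool" where
  "simple_graph G \<longleftrightarrow> (\<forall>e\<in>edges G. e \<subseteq> verts G \<and> card e = 2)"

definition connected_graph :: "'a sgraph \<Rightarrow> bool" where
  "connected_graph G \<longleftrightarrow> verts G \<noteq> {} \<and>
     (\<forall>u\<in>verts G. \<forall>v\<in>verts G. (u, v) \<in> {(a, b). {a, b} \<in> edges G}\<^sup>*)"

definition remove_edge :: "'a sgraph \<Rightarrow> 'a set \<Rightarrow> 'a sgraph" where
  "remove_edge G e = \<lparr>verts = verts G, edges = edges G - {e}\<rparr>"

definition merge :: "'a set \<Rightarrow> 'a \<Rightarrow> 'a \<Rightarrow> 'a" where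
  "merge e c v = (if v \<in> e then c else v)"

text \<open>The vertex \<open>c\<close> is the one into which the endpoints of \<open>e\<close> are merged. In a simple graph,
  \<open>e\<close> is the only edge whose image under the merging map degenerates, and parallel edges
  produced by merging coincide as sets.\<close>

definition contract_edge :: "'a sgraph \<Rightarrow> 'a set \<Rightarrow> 'a \<Rightarrow> 'a sgraph" where
  "contract_edge G e c =
     \<lparr>verts = merge e c ` verts G, edges = (\<lambda>f. merge e c ` f) ` (edges G - {e})\<rparr>"

text \<open>The name \<open>c\<close> of the merged vertex is arbitrary, as long as it does not clash with a
  vertex that survives the contraction; in particular it may be an endpoint of \<open>e\<close>.\<close>

inductive edge_step :: "'a sgraph \<Rightarrow> 'a sgraph \<Rightarrow> bool" where
  remove: "e \<in> edges G \<Longrightarrow> edge_step G (remove_edge G e)"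
| contract: "e \<in> edges G \<Longrightarrow> c \<notin> verts G - e \<Longrightarrow> edge_step G (contract_edge G e c)"

section \<open>A graph as a metric space\<close>

text \<open>Points are given by barycentric coordinates: \<open>edge_point u v t\<close> is the point at distance
  \<open>t\<close> from \<open>u\<close> on the edge joining \<open>u\<close> and \<open>v\<close>, and \<open>edge_point v v 0\<close> is the vertex \<open>v\<close>.
  The point does not depend on the orientation of the edge, and the endpoints of an edge are
  identified with the corresponding vertices.\<close>

definition edge_point :: "'a \<Rightarrow> 'a \<Rightarrow> real \<Rightarrow> 'a \<Rightarrow> real" where
  "edge_point u v t = (\<lambda>w. (1 - t) * of_bool (w = u) + t * of_bool (w = v))"

definition points :: "'a sgraph \<Rightarrow> ('a \<Rightarrow> real) set" where
  "points G = {edge_point v v 0 |v. v \<in> verts G} \<union>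
     {edge_point u v t |u v t. {u, v} \<in> edges G \<and> t \<in> {0..1}}"

text \<open>\<open>path_of_length G p q l\<close>: there is a path from \<open>p\<close> to \<open>q\<close> of length \<open>l\<close>
  made of finitely many segments, each contained in an edge of length 1.\<close>

inductive path_of_length :: "'a sgraph \<Rightarrow> ('a \<Rightarrow> real) \<Rightarrow> ('a \<Rightarrow> real) \<Rightarrow> real \<Rightarrow> bool"
  for G where
  refl: "p \<in> points G \<Longrightarrow> path_of_length G p p 0"
| step: "path_of_length G p (edge_point u v s) l \<Longrightarrow> {u, v} \<in> edges G \<Longrightarrow>
    s \<in> {0..1} \<Longrightarrow> t \<in> {0..1} \<Longrightarrow> path_of_length G p (edge_point u v t) (l + \<bar>s - t\<bar>)"

text \<open>The value 0 is a default for pairs not joined by a path: \<^locale>\<open>Metric_space\<close>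
  asks for non-negativity outside the carrier as well.\<close>

definition graph_dist :: "'a sgraph \<Rightarrow> ('a \<Rightarrow> real) \<Rightarrow> ('a \<Rightarrow> real) \<Rightarrow> real" where
  "graph_dist G p q =
     (if \<exists>l. path_of_length G p q l then Inf {l. path_of_length G p q l} else 0)"

lemma path_in_points:
  "path_of_length G p q l \<Longrightarrow> p \<in> points G \<and> q \<in> points G \<and> \<bar>p w - q w\<bar> \<le> l"
proof (induction rule: path_of_length.induct)
  case (step p u v s l t)
  have "edge_point u v s w - edge_point u v t w = (s - t) * (of_bool (w = v) - of_bool (w = u))"
    by (simp add: edge_point_def algebra_simps)
  then have "\<bar>edge_point u v s w - edge_point u v t w\<bar> \<le> \<bar>s - t\<bar>"
    by auto
  then show ?case using step by (auto simp: points_def)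
qed simp

lemma path_trans:
  "path_of_length G q r l' \<Longrightarrow> path_of_length G p q l \<Longrightarrow> path_of_length G p r (l + l')"
proof (induction arbitrary: l rule: path_of_length.induct)
  case (step q u v s l' t)
  then have "path_of_length G p (edge_point u v t) (l + l' + \<bar>s - t\<bar>)"
    by (blast intro: path_of_length.step)
  then show ?case by (simp add: add.assoc)
qed simp

lemma path_segment:
  assumes "{u, v} \<in> edges G" "s \<in> {0..1}" "t \<in> {0..1}"
  shows "path_of_length G (edge_point u v s) (edge_point u v t) \<bar>s - t\<bar>"
proof -
  have "edge_point u v s \<in> points G" using assms by (auto simp: points_def)
  from path_of_length.step[OF path_of_length.refl[OF this] assms] show ?thesis by simp
qed

lemma path_sym: "path_of_length G p q l \<Longrightarrow> path_of_length G q p l"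
proof (induction rule: path_of_length.induct)
  case (step p u v s l t)
  have "path_of_length G (edge_point u v t) p (\<bar>t - s\<bar> + l)"
    using path_trans[OF step.IH path_segment] step by blast
  then show ?case by (simp add: add.commute abs_minus_commute)
qed (rule path_of_length.refl)

lemma edge_point_ends: "edge_point u v 0 = edge_point u u 0" "edge_point u v 1 = edge_point v v 0"
  by (auto simp: edge_point_def)

lemma path_vertices:
  assumes "(u, v) \<in> {(a, b). {a, b} \<in> edges G}\<^sup>*" "u \<in> verts G"
  shows "\<exists>l. path_of_length G (edge_point u u 0) (edge_point v v 0) l"
  using assms
proof (induction rule: rtrancl_induct)
  case base
  then show ?case by (auto simp: points_def intro!: exI path_of_length.refl)
next
  case (step a b)
  then obtain l where l: "path_of_length G (edge_point u u 0) (edge_point a a 0) l" by blast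
  have "path_of_length G (edge_point a a 0) (edge_point b b 0) \<bar>0 - 1\<bar>"
    using path_segment[of a b G 0 1] step by (simp add: edge_point_ends(2) edge_point_ends(1)[of a b])
  from path_trans[OF this l] show ?case by blast
qed

lemma path_to_vertex:
  assumes "simple_graph G" "p \<in> points G"
  shows "\<exists>v\<in>verts G. \<exists>l. path_of_length G p (edge_point v v 0) l"
proof -
  consider v where "v \<in> verts G" "p = edge_point v v 0"
    | u v t where "{u, v} \<in> edges G" "t \<in> {0..1}" "p = edge_point u v t"
    using assms by (auto simp: points_def)
  then show ?thesis
  proof cases
    case 1
    then show ?thesis using assms path_of_length.refl by blast
  next
    case 2
    then have "u \<in> verts G" using assms by (auto simp: simple_graph_def)
    moreover have "path_of_length G p (edge_point u u 0) \<bar>t - 0\<bar>"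
      unfolding edge_point_ends(1)[of u v, symmetric] 2(3)
      by (rule path_segment) (use 2 in auto)
    ultimately show ?thesis by blast
  qed
qed

lemma path_exists:
  assumes "simple_graph G" "connected_graph G" "p \<in> points G" "q \<in> points G"
  shows "\<exists>l. path_of_length G p q l"
proof -
  obtain u k where u: "u \<in> verts G" "path_of_length G p (edge_point u u 0) k"
    using path_to_vertex assms by blast
  obtain v l where v: "v \<in> verts G" "path_of_length G q (edge_point v v 0) l"
    using path_to_vertex assms by blast
  obtain m where "path_of_length G (edge_point u u 0) (edge_point v v 0) m"
    using path_vertices assms(2) u v by (metis connected_graph_def)
  then show ?thesis using path_trans path_sym u v by metis
qed

lemma graph_dist_le: "path_of_length G p q l \<Longrightarrow> graph_dist G p q \<le> l"
  unfolding graph_dist_def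
  by (auto intro!: cInf_lower bdd_belowI[of _ 0] dest: path_in_points)

lemma graph_dist_ge:
  assumes "\<exists>l. path_of_length G p q l" "\<And>l. path_of_length G p q l \<Longrightarrow> k \<le> l"
  shows "k \<le> graph_dist G p q"
  unfolding graph_dist_def using assms by (auto intro!: cInf_greatest)

lemma graph_dist_edge:
  assumes "{u, v} \<in> edges G" "u \<noteq> v" "s \<in> {0..1}" "t \<in> {0..1}"
  shows "graph_dist G (edge_point u v s) (edge_point u v t) = \<bar>s - t\<bar>"
proof (rule antisym)
  show "\<bar>s - t\<bar> \<le> graph_dist G (edge_point u v s) (edge_point u v t)"
  proof (rule graph_dist_ge)
    fix l assume "path_of_length G (edge_point u v s) (edge_point u v t) l"
    from path_in_points[OF this, of v] show "\<bar>s - t\<bar> \<le> l"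
      using assms by (simp add: edge_point_def)
  qed (use path_segment[OF assms(1,3,4)] in blast)
qed (use graph_dist_le path_segment[OF assms(1,3,4)] in blast)

lemma Metric_space_graph:
  assumes "simple_graph G" "connected_graph G"
  shows "Metric_space (points G) (graph_dist G)"
proof
  show nn: "0 \<le> graph_dist G p q" for p q
  proof (cases "\<exists>l. path_of_length G p q l")
    case True
    then show ?thesis by (rule graph_dist_ge) (auto dest: path_in_points)
  next
    case False
    then show ?thesis by (simp add: graph_dist_def)
  qed
  show "graph_dist G p q = graph_dist G q p" for p q
  proof -
    have "path_of_length G p q = path_of_length G q p"
      using path_sym by (intro ext iffI)
    then show ?thesis unfolding graph_dist_def
      by (rule arg_cong[where f = "\<lambda>P. if \<exists>l. P l then Inf {l. P l} else 0"])
  qed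
  have ex: "\<exists>l. path_of_length G p q l" if "p \<in> points G" "q \<in> points G" for p q
    by (rule path_exists[OF assms that])
  fix p q assume pq: "p \<in> points G" "q \<in> points G"
  show "graph_dist G p q = 0 \<longleftrightarrow> p = q"
  proof
    assume 0: "graph_dist G p q = 0"
    have "\<bar>p w - q w\<bar> \<le> graph_dist G p q" for w
    proof (rule graph_dist_ge[OF ex[OF pq]])
      show "\<bar>p w - q w\<bar> \<le> l" if "path_of_length G p q l" for l
        using path_in_points[OF that] by simp
    qed
    then show "p = q" unfolding 0 by (simp add: fun_eq_iff)
  next
    assume "p = q"
    then have "graph_dist G p q \<le> 0"
      using graph_dist_le path_of_length.refl[OF pq(1)] by simp
    then show "graph_dist G p q = 0" using nn[of p q] by linarith
  qed
  fix r assume r: "r \<in> points G"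
  have *: "graph_dist G p r - k \<le> graph_dist G q r" if "path_of_length G p q k" for k
  proof (rule graph_dist_ge[OF ex[OF pq(2) r]])
    show "graph_dist G p r - k \<le> l" if l: "path_of_length G q r l" for l
      using graph_dist_le[OF path_trans[OF l \<open>path_of_length G p q k\<close>]] by linarith
  qed
  have "graph_dist G p r - graph_dist G q r \<le> graph_dist G p q"
  proof (rule graph_dist_ge[OF ex[OF pq]])
    show "graph_dist G p r - graph_dist G q r \<le> l" if "path_of_length G p q l" for l
      using *[OF that] by linarith
  qed
  then show "graph_dist G p r \<le> graph_dist G p q + graph_dist G q r" by simp
qed

definition hyperbolic_graph :: "'a sgraph \<Rightarrow> bool" where
  "hyperbolic_graph G \<longleftrightarrow> Metric_space.hyperbolic (points G) (graph_dist G)"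

end

theory Submission
  imports Defs
begin

text \<open>Removing or contracting one edge changes distances between vertices by a bounded additive
  amount only, because a shortest path uses the edge at most once. Gromov's four-point condition is
  visibly stable under such a change, and on the vertices of a graph it is equivalent to thinness of
  geodesic triangles. The intermediate graphs are connected because neither operation can connect
  a disconnected graph.\<close>

section \<open>The four-point condition\<close>

definition four_point :: "('a \<Rightarrow> 'a \<Rightarrow> real) \<Rightarrow> 'a set \<Rightarrow> real \<Rightarrow> bool" where
  "four_point d S k \<longleftrightarrow> (\<forall>x\<in>S. \<forall>y\<in>S. \<forall>z\<in>S. \<forall>w\<in>S.
     d x y + d z w \<le> max (d x z + d y w) (d x w + d y z) + k)"

lemma four_pointD:
  assumes "four_point d S k" "x \<in> S" "y \<in> S" "z \<in> S" "w \<in> S"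
  shows "d x y + d z w \<le> max (d x z + d y w) (d x w + d y z) + k"
  using assms by (auto simp: four_point_def)

text \<open>Both sides are built from sums of two distances, so each side moves by at most
  \<open>2 * C\<close>.\<close>

lemma four_point_rough_isometry:
  assumes four: "four_point d' T k" and f: "\<And>x. x \<in> S \<Longrightarrow> f x \<in> T"
    and rough: "\<And>x y. x \<in> S \<Longrightarrow> y \<in> S \<Longrightarrow> \<bar>d x y - d' (f x) (f y)\<bar> \<le> C"
  shows "four_point d S (k + 4 * C)"
  unfolding four_point_def
proof (intro ballI)
  fix x y z w assume S: "x \<in> S" "y \<in> S" "z \<in> S" "w \<in> S"
  show "d x y + d z w \<le> max (d x z + d y w) (d x w + d y z) + (k + 4 * C)"
    using four_pointD[OF four f f f f, OF S] rough[of x y] rough[of z w] rough[of x z]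
      rough[of y w] rough[of x w] rough[of y z] S by (auto simp: max_def abs_le_iff split: if_splits)
qed

context Metric_space
begin

section \<open>Points on geodesics\<close>

lemma geodesic_subset: "geodesic x y S \<Longrightarrow> S \<subseteq> M"
  by (auto simp: geodesic_def)

lemma geodesic_ends: "geodesic x y S \<Longrightarrow> x \<in> S \<and> y \<in> S"
  unfolding geodesic_def by (auto intro: image_eqI[of _ _ 0] image_eqI[of _ _ "d x y"])

lemma geodesic_between:
  assumes "geodesic x y S" "p \<in> S"
  shows "d x p + d p y = d x y"
proof -
  obtain g t where g: "g 0 = x" "g (d x y) = y" "t \<in> {0..d x y}" "p = g t"
    "\<forall>s\<in>{0..d x y}. \<forall>t\<in>{0..d x y}. d (g s) (g t) = \<bar>s - t\<bar>"
    using assms unfolding geodesic_def by auto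
  then have "d x p = t" "d p y = d x y - t"
    using g(5)[rule_format, of 0 t] g(5)[rule_format, of t "d x y"] by auto
  then show ?thesis by simp
qed

lemma geodesic_point:
  assumes "geodesic x y S" "0 \<le> a" "a \<le> d x y"
  shows "\<exists>q\<in>S. d x q = a \<and> d q y = d x y - a"
proof -
  obtain g where g: "g 0 = x" "g (d x y) = y" "S = g ` {0..d x y}"
    "\<forall>s\<in>{0..d x y}. \<forall>t\<in>{0..d x y}. d (g s) (g t) = \<bar>s - t\<bar>"
    using assms unfolding geodesic_def by auto
  then have "d x (g a) = a" "d (g a) y = d x y - a"
    using g(4)[rule_format, of 0 a] g(4)[rule_format, of a "d x y"] assms by auto
  then show ?thesis using g assms by auto
qed

section \<open>Thin triangles imply the four-point condition\<close>

text \<open>The geodesic starts near \<open>A\<close> and ends near \<open>B\<close>, so somewhere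
  it changes from one to the other. A step of length 1 across the change replaces a limit argument
  and costs the extra 1.\<close>

lemma geodesic_crossing:
  assumes S: "geodesic x y S" and cover: "S \<subseteq> nbhd \<delta> (A \<union> B)" and "0 \<le> \<delta>"
    and A: "x \<in> A" and B: "y \<in> B" "B \<subseteq> M"
  shows "\<exists>p\<in>S. (\<exists>q\<in>A. d p q \<le> \<delta>) \<and> (\<exists>r\<in>B. d p r \<le> \<delta> + 1)"
proof -
  obtain g where g: "g 0 = x" "g (d x y) = y" "S = g ` {0..d x y}"
    "\<forall>s\<in>{0..d x y}. \<forall>t\<in>{0..d x y}. d (g s) (g t) = \<bar>s - t\<bar>"
    using S unfolding geodesic_def by auto
  have SM: "S \<subseteq> M" using geodesic_subset[OF S] .
  define T where "T = {t \<in> {0..d x y}. \<exists>q\<in>A. d (g t) q \<le> \<delta>}"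
  have xM: "x \<in> M" using geodesic_ends[OF S] SM by auto
  have "0 \<in> T" using A g(1) xM \<open>0 \<le> \<delta>\<close> by (auto simp: T_def intro!: bexI[of _ x])
  moreover have bdd: "bdd_above T" by (auto simp: T_def)
  \<comment> \<open>The supremum need not be attained, so \<open>t\<close> is only taken within 1 of
    it; \<open>t + 1\<close> then lies beyond \<open>T\<close>, where the cover can only come from
    \<open>B\<close>.\<close>
  ultimately obtain t where t: "t \<in> T" "Sup T - 1 < t"
    using less_cSupD[of T "Sup T - 1"] by auto
  define t' where "t' = min (t + 1) (d x y)"
  have t01: "t \<in> {0..d x y}" "t' \<in> {0..d x y}" "\<bar>t - t'\<bar> \<le> 1"
    using t by (auto simp: t'_def T_def)
  have near: "\<exists>r\<in>B. d (g t') r \<le> \<delta>"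
  proof (cases "t + 1 \<le> d x y")
    case True
    then have "t' \<notin> T" using cSup_upper[OF _ bdd, of t'] t by (auto simp: t'_def)
    moreover have "g t' \<in> nbhd \<delta> (A \<union> B)" using cover g(3) t01 by blast
    ultimately show ?thesis using t01 by (auto simp: nbhd_def T_def)
  next
    case False
    then show ?thesis using g(2) B \<open>0 \<le> \<delta>\<close> by (auto simp: t'_def intro!: bexI[of _ y])
  qed
  then obtain r where r: "r \<in> B" "d (g t') r \<le> \<delta>" by blast
  have "d (g t) r \<le> d (g t) (g t') + d (g t') r"
    using t01 r B SM g(3) by (intro triangle) auto
  also have "\<dots> \<le> \<delta> + 1" using g(4) t01 r by auto
  finally show ?thesis using t(1) t01 g(3) r(1) by (auto simp: T_def)
qed

text \<open>Up to a constant, the distance from \<open>w\<close> to a geodesic \<open>[xy]\<close> is the Gromov product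
  \<open>(x|y)\<^sub>w\<close>; this lemma and the next one give the two bounds.\<close>

lemma hyperbolic_gromov_product:
  assumes hyp: "hyperbolic_const \<delta>" "0 \<le> \<delta>" and M: "x \<in> M" "y \<in> M" "w \<in> M"
    and S: "geodesic x y S" "geodesic y w S'" "geodesic w x S''"
  shows "\<exists>p\<in>S. 2 * d w p \<le> d x w + d y w - d x y + 4 * \<delta> + 2"
proof -
  have "S \<subseteq> nbhd \<delta> (S'' \<union> S')"
    using hyp M S unfolding hyperbolic_const_def thin_triangle_def by (metis Un_commute)
  \<comment> \<open>The crossing point \<open>p\<close> is close to both sides that meet at
    \<open>w\<close>.\<close>
  then obtain p q r where p: "p \<in> S" "q \<in> S''" "d p q \<le> \<delta>" "r \<in> S'" "d p r \<le> \<delta> + 1"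
    using geodesic_crossing[OF S(1) _ hyp(2), of S'' S'] geodesic_ends[OF S(2)]
      geodesic_ends[OF S(3)] geodesic_subset[OF S(2)] by blast
  have pqr: "p \<in> M" "q \<in> M" "r \<in> M" using p S geodesic_subset by blast+
  \<comment> \<open>Since \<open>q\<close> lies on \<open>[wx]\<close> and \<open>r\<close> on
    \<open>[yw]\<close>, adding all four bounds gives \<open>2 * d w p + d x y \<le> d x w + d y w +
    2 * \<delta> + 2 * (\<delta> + 1)\<close>.\<close>
  have "d w p \<le> d w q + d p q" "d x p \<le> d x q + d p q"
       "d w p \<le> d w r + d p r" "d y p \<le> d y r + d p r"
    using triangle[of w q p] triangle[of x q p] triangle[of w r p]
      triangle[of y r p] M pqr by (simp_all add: commute)
  with geodesic_between[OF S(1) p(1)] geodesic_between[OF S(2) p(4)]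
    geodesic_between[OF S(3) p(2)] p
  have "2 * d w p \<le> d x w + d y w - d x y + 4 * \<delta> + 2" by (simp add: commute)
  then show ?thesis using p by blast
qed

lemma gromov_product_le:
  assumes S: "geodesic x y S" "p \<in> S" and M: "x \<in> M" "y \<in> M" "w \<in> M"
  shows "d x w + d y w - d x y \<le> 2 * d w p"
proof -
  have "p \<in> M" using S geodesic_subset by blast
  then show ?thesis
    using geodesic_between[OF S] triangle[of x p w] triangle[of y p w] M by (simp add: commute)
qed

text \<open>A point \<open>p\<close> of \<open>[xz]\<close> nearly realises the Gromov product of
  \<open>x\<close> and \<open>z\<close> at \<open>w\<close>. Thinness moves it to a point
  \<open>q\<close> of \<open>[zy]\<close> or \<open>[yx]\<close>, whose distance from
  \<open>w\<close> bounds the product for that side from above. The constant is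
  \<open>4 * \<delta> + 2\<close> for choosing \<open>p\<close> plus \<open>2 * \<delta>\<close> for
  moving to \<open>q\<close>. The set \<open>V\<close> allows geodesics to be supplied for vertices
  only.\<close>

lemma hyperbolic_imp_four_point:
  assumes hyp: "hyperbolic_const \<delta>" "0 \<le> \<delta>" and V: "V \<subseteq> M"
    and geo: "\<And>x y. x \<in> V \<Longrightarrow> y \<in> V \<Longrightarrow> \<exists>S. geodesic x y S"
  shows "four_point d V (6 * \<delta> + 2)"
  unfolding four_point_def
proof (intro ballI)
  fix x z y w assume xyzw: "x \<in> V" "z \<in> V" "y \<in> V" "w \<in> V"
  then have M: "x \<in> M" "y \<in> M" "z \<in> M" "w \<in> M" using V by auto
  obtain S1 S2 S3 S4 S5 where S: "geodesic x z S1" "geodesic z w S2" "geodesic w x S3"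
      "geodesic z y S4" "geodesic y x S5"
    using geo xyzw by meson
  obtain p where p: "p \<in> S1" "2 * d w p \<le> d x w + d z w - d x z + 4 * \<delta> + 2"
    using hyperbolic_gromov_product[OF hyp M(1,3,4) S(1,2,3)] by blast
  have "S1 \<subseteq> nbhd \<delta> (S4 \<union> S5)"
    using hyp M S unfolding hyperbolic_const_def thin_triangle_def by metis
  then obtain q where q: "q \<in> S4 \<union> S5" "d p q \<le> \<delta>" using p by (auto simp: nbhd_def)
  have pq: "p \<in> M" "q \<in> M" using p q S geodesic_subset by blast+
  have "d w q \<le> d w p + \<delta>" using triangle[of w p q] M pq q by simp
  moreover have "d z w + d y w - d z y \<le> 2 * d w q \<or> d y w + d x w - d y x \<le> 2 * d w q"
    using q gromov_product_le[OF S(4) _ M(3,2,4)] gromov_product_le[OF S(5) _ M(2,1,4)] by auto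
  ultimately show "d x z + d y w \<le> max (d x y + d z w) (d x w + d z y) + (6 * \<delta> + 2)"
    using p(2) by (auto simp: commute max_def)
qed

section \<open>The four-point condition implies thin triangles\<close>

text \<open>Compare \<open>p\<close> with the point \<open>q\<close> of \<open>S\<close> at the same
  distance from \<open>x\<close>: in the four-point inequality for \<open>x\<close>,
  \<open>z\<close>, \<open>p\<close>, \<open>q\<close> both sums on the right are at most
  \<open>d x z + k\<close>. Both orientations of \<open>S\<close> are allowed because the sides of a
  triangle are oriented cyclically.\<close>

lemma four_point_near_geodesic:
  assumes four: "four_point d M k" and "0 \<le> k" and S: "geodesic x z S \<or> geodesic z x S"
    and M: "x \<in> M" "z \<in> M" "p \<in> M" and p: "d x p + d p z \<le> d x z + k"
  shows "\<exists>q\<in>S. d p q \<le> 2 * k"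
proof (cases "d x p \<le> d x z")
  case True
  obtain q where q: "q \<in> S" "d x q = d x p" "d q z = d x z - d x p"
    using S
  proof
    assume "geodesic x z S"
    from geodesic_point[OF this _ True] show ?thesis using that by auto
  next
    assume "geodesic z x S"
    from geodesic_point[OF this, of "d x z - d x p"] show ?thesis
      using that True by (auto simp: commute)
  qed
  then have "q \<in> M" using S geodesic_subset by blast
  from four_pointD[OF four M this] q p \<open>0 \<le> k\<close> have "d p q \<le> 2 * k"
    by (auto simp: commute max_def split: if_splits)
  then show ?thesis using q by blast
next
  \<comment> \<open>Here \<open>p\<close> is farther from \<open>x\<close> than \<open>z\<close> is,
    so the near-betweenness bound forces \<open>d p z \<le> k\<close>.\<close>
  case False
  then show ?thesis using S p \<open>0 \<le> k\<close> geodesic_ends by (intro bexI[of _ z]) auto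
qed

lemma four_point_imp_side_subset:
  assumes four: "four_point d M k" and "0 \<le> k" and M: "x \<in> M" "y \<in> M" "z \<in> M"
    and S: "geodesic x y S1" "geodesic y z S2" "geodesic z x S3"
  shows "S1 \<subseteq> nbhd (2 * k) (S2 \<union> S3)"
proof
  fix p assume p: "p \<in> S1"
  then have pM: "p \<in> M" using S geodesic_subset by blast
  \<comment> \<open>The four-point inequality for \<open>x\<close>, \<open>y\<close>,
    \<open>z\<close>, \<open>p\<close> with \<open>d x y = d x p + d p y\<close>: one of the two
    terms cancels in each case of the maximum.\<close>
  have "d x p + d p z \<le> d x z + k \<or> d y p + d p z \<le> d y z + k"
    using four_pointD[OF four M pM] geodesic_between[OF S(1) p]
    by (auto simp: commute max_def split: if_splits)
  then have "\<exists>q\<in>S2 \<union> S3. d p q \<le> 2 * k"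
  proof
    assume "d x p + d p z \<le> d x z + k"
    from four_point_near_geodesic[OF four \<open>0 \<le> k\<close> _ M(1,3) pM this] S(3) show ?thesis by blast
  next
    assume "d y p + d p z \<le> d y z + k"
    from four_point_near_geodesic[OF four \<open>0 \<le> k\<close> _ M(2,3) pM this] S(2) show ?thesis by blast
  qed
  then show "p \<in> nbhd (2 * k) (S2 \<union> S3)" using pM by (auto simp: nbhd_def)
qed

lemma four_point_imp_hyperbolic:
  assumes "four_point d M k" "0 \<le> k"
  shows "hyperbolic_const (2 * k)"
  unfolding hyperbolic_const_def thin_triangle_def
proof (intro ballI allI impI conjI)
  fix x y z S1 S2 S3
  assume M: "x \<in> M" "y \<in> M" "z \<in> M"
    and S: "geodesic x y S1" "geodesic y z S2" "geodesic z x S3"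
  note side = four_point_imp_side_subset[OF assms]
  show "S1 \<subseteq> nbhd (2 * k) (S2 \<union> S3)" using side[OF M S] .
  show "S2 \<subseteq> nbhd (2 * k) (S1 \<union> S3)" using side[OF M(2,3,1) S(2,3,1)] by (simp add: Un_commute)
  show "S3 \<subseteq> nbhd (2 * k) (S1 \<union> S2)" using side[OF M(3,1,2) S(3,1,2)] .
qed

end

section \<open>Distances between vertices\<close>

text \<open>As a relation, its power \<open>adj G ^^ n\<close> describes walks with \<open>n\<close>
  edges.\<close>

abbreviation adj :: "'a sgraph \<Rightarrow> ('a \<times> 'a) set" where
  "adj G \<equiv> {(a, b). {a, b} \<in> edges G}"

abbreviation vertex :: "'a \<Rightarrow> 'a \<Rightarrow> real" where
  "vertex v \<equiv> edge_point v v 0"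

definition vdist :: "'a sgraph \<Rightarrow> 'a \<Rightarrow> 'a \<Rightarrow> real" where
  "vdist G u v = graph_dist G (vertex u) (vertex v)"

lemma simple_edgeD:
  assumes "simple_graph G" "{a, b} \<in> edges G"
  shows "a \<in> verts G" "b \<in> verts G" "a \<noteq> b"
  using assms by (auto simp: simple_graph_def)

lemma simple_edge_cases:
  assumes "simple_graph G" "e \<in> edges G"
  obtains a b where "e = {a, b}" "a \<noteq> b" "a \<in> verts G" "b \<in> verts G"
  using assms by (force simp: simple_graph_def card_2_iff)

lemma vertex_in_points: "v \<in> verts G \<Longrightarrow> vertex v \<in> points G"
  by (auto simp: points_def)

section \<open>Paths, walks and geodesics between vertices\<close>

lemma path_of_walk:
  assumes "u \<in> verts G"
  shows "(u, v) \<in> adj G ^^ n \<Longrightarrow> path_of_length G (vertex u) (vertex v) (real n)"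
proof (induction n arbitrary: v)
  case 0
  then show ?case using assms by (auto intro: path_of_length.refl vertex_in_points)
next
  case (Suc n)
  then obtain w where w: "path_of_length G (vertex u) (vertex w) (real n)" "{w, v} \<in> edges G"
    by auto
  have "path_of_length G (vertex w) (vertex v) \<bar>0 - 1\<bar>"
    using path_segment[OF w(2), of 0 1] by (simp add: edge_point_ends(2) edge_point_ends(1)[of w v])
  from path_trans[OF this w(1)] show ?case by (simp add: add.commute)
qed

text \<open>A path from \<open>u\<close> to the point \<open>q\<close> reaches some endpoint \<open>w\<close> of the edge containing \<open>q\<close>
  at its last vertex, and \<open>1 - q w\<close> is the distance from \<open>w\<close> to \<open>q\<close>.\<close>

lemma walk_of_path:
  assumes simple: "simple_graph G"
  shows "path_of_length G p q l \<Longrightarrow> p = vertex u \<Longrightarrow>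
    \<exists>w n. q w > 0 \<and> (u, w) \<in> adj G ^^ n \<and> real n + 1 - q w \<le> l"
proof (induction rule: path_of_length.induct)
  case (refl p)
  then show ?case by (intro exI[of _ u] exI[of _ 0]) (auto simp: edge_point_def)
next
  case (step p a b s l t)
  then obtain w n where w: "edge_point a b s w > 0" "(u, w) \<in> adj G ^^ n"
    "real n + 1 - edge_point a b s w \<le> l" by blast
  have ab: "a \<noteq> b" using simple_edgeD[OF simple step.hyps(2)] by simp
  have sym: "{b, a} \<in> edges G" using step.hyps(2) by (simp add: insert_commute)
  have ep: "edge_point a b x a = 1 - x" "edge_point a b x b = x" for x
    using ab by (auto simp: edge_point_def)
  have next_a: "(u, b) \<in> adj G ^^ Suc n" if "w = a" using that w(2) step.hyps(2) by auto
  have next_b: "(u, a) \<in> adj G ^^ Suc n" if "w = b" using that w(2) sym by auto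
  \<comment> \<open>Positivity of the coordinate is carried along precisely to identify
    \<open>w\<close> as an endpoint of the current edge.\<close>
  have "w = a \<or> w = b" using w(1) by (auto simp: edge_point_def of_bool_def split: if_splits)
  then show ?case
  proof
    assume wa: "w = a"
    show ?thesis
    \<comment> \<open>Before reaching \<open>b\<close> the endpoint \<open>a\<close> still serves.
      At \<open>t = 1\<close> its coordinate vanishes, so the walk is extended to \<open>b\<close>;
      the lower bound is \<open>n + t\<close> either way.\<close>
    proof (cases "t < 1")
      case True
      then show ?thesis using w wa step.hyps
        by (intro exI[of _ a] exI[of _ n]) (auto simp: ep)
    next
      case False
      then show ?thesis using w wa step.hyps next_a[OF wa]
        by (intro exI[of _ b] exI[of _ "Suc n"]) (auto simp: ep simp del: relpow.simps)
    qed
  next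
    assume wb: "w = b"
    show ?thesis
    proof (cases "t > 0")
      case True
      then show ?thesis using w wb step.hyps
        by (intro exI[of _ b] exI[of _ n]) (auto simp: ep)
    next
      case False
      then show ?thesis using w wb step.hyps next_b[OF wb]
        by (intro exI[of _ a] exI[of _ "Suc n"]) (auto simp: ep simp del: relpow.simps)
    qed
  qed
qed

lemma vdist_le_walk: "u \<in> verts G \<Longrightarrow> (u, v) \<in> adj G ^^ n \<Longrightarrow> vdist G u v \<le> real n"
  unfolding vdist_def by (intro graph_dist_le path_of_walk)

text \<open>Any path between vertices dominates a walk in length, so the infimum is attained by a
  walk with the least number of edges.\<close>

lemma vdist_walk:
  assumes "simple_graph G" "connected_graph G" "u \<in> verts G" "v \<in> verts G"
  obtains n where "(u, v) \<in> adj G ^^ n" "vdist G u v = real n"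
proof -
  have "(u, v) \<in> (adj G)\<^sup>*" using assms by (auto simp: connected_graph_def)
  then have ex: "\<exists>n. (u, v) \<in> adj G ^^ n" by (simp add: rtrancl_power)
  define n where "n = (LEAST n. (u, v) \<in> adj G ^^ n)"
  have n: "(u, v) \<in> adj G ^^ n" unfolding n_def using ex by (rule LeastI_ex)
  have "real n \<le> vdist G u v" unfolding vdist_def
  proof (rule graph_dist_ge)
    show "\<exists>l. path_of_length G (vertex u) (vertex v) l" using path_of_walk[OF assms(3) n] by blast
    fix l assume "path_of_length G (vertex u) (vertex v) l"
    from walk_of_path[OF assms(1) this HOL.refl] obtain w m where
      w: "vertex v w > 0" "(u, w) \<in> adj G ^^ m" "real m + 1 - vertex v w \<le> l" by blast
    \<comment> \<open>Only \<open>v\<close> itself has a positive coordinate at the vertex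
      \<open>v\<close>, and it equals 1, so the bound reads \<open>real m \<le> l\<close>.\<close>
    then have "w = v" by (auto simp: edge_point_def split: if_splits)
    then have "n \<le> m" "real m \<le> l"
      using w by (auto simp: n_def edge_point_def intro: Least_le)
    then show "real n \<le> l" by linarith
  qed
  with vdist_le_walk[OF assms(3) n] show ?thesis using that n by force
qed

text \<open>A shortest walk parametrised by arc length is a geodesic: its total length equals the
  distance of its ends, so no piece of it can be shortened.\<close>

lemma vertices_geodesic:
  assumes G: "simple_graph G" "connected_graph G" and uv: "u \<in> verts G" "v \<in> verts G"
  shows "\<exists>S. Metric_space.geodesic (points G) (graph_dist G) (vertex u) (vertex v) S"
proof -
  interpret Metric_space "points G" "graph_dist G" by (rule Metric_space_graph[OF G])
  obtain n where n: "(u, v) \<in> adj G ^^ n" "vdist G u v = real n"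
    using vdist_walk[OF G uv] .
  obtain w where w: "w 0 = u" "w n = v" "\<And>i. i < n \<Longrightarrow> {w i, w (Suc i)} \<in> edges G"
    using n(1) by (auto simp: relpow_fun_conv)
  \<comment> \<open>Between \<open>k\<close> and \<open>k + 1\<close> the curve runs along the edge
    from \<open>w k\<close> to \<open>w (Suc k)\<close>. At \<open>s = n\<close> the value
    \<open>w (Suc n)\<close> is unspecified, but it receives weight 0.\<close>
  define g where "g s = edge_point (w (nat \<lfloor>s\<rfloor>)) (w (Suc (nat \<lfloor>s\<rfloor>))) (s - real (nat \<lfloor>s\<rfloor>))" for s
  have g_nat: "g (real k) = vertex (w k)" for k
    by (simp add: g_def edge_point_ends(1)[of "w k" "w (Suc k)"])
  \<comment> \<open>The formula for the \<open>k\<close>-th edge is also valid at its right end,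
    where the floor has already jumped.\<close>
  have g_seg: "g s = edge_point (w k) (w (Suc k)) (s - real k)"
    if "real k \<le> s" "s \<le> real (Suc k)" for k s
  proof (cases "s = real (Suc k)")
    case True
    then show ?thesis unfolding True g_nat by (simp add: edge_point_ends(2))
  next
    case False
    then have "nat \<lfloor>s\<rfloor> = k" using that by linarith
    then show ?thesis by (simp add: g_def)
  qed
  have seg: "path_of_length G (g s) (g t) (t - s)"
    if "k < n" "real k \<le> s" "s \<le> t" "t \<le> real (Suc k)" for k s t
    using path_segment[OF w(3)[OF that(1)], of "s - real k" "t - real k"] that
    by (simp add: g_seg[of k s] g_seg[of k t])
  have pts: "g s \<in> points G" if "0 \<le> s" "s \<le> real n" for s
  proof (cases "s = real n")
    case True
    then show ?thesis using g_nat w uv by (simp add: vertex_in_points)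
  next
    case False
    then have "nat \<lfloor>s\<rfloor> < n" "real (nat \<lfloor>s\<rfloor>) \<le> s" "s \<le> real (Suc (nat \<lfloor>s\<rfloor>))"
      using that by linarith+
    from path_in_points[OF seg[OF this(1,2) order_refl this(3)]] show ?thesis by simp
  qed
  have path: "path_of_length G (g s) (g t) (t - s)"
    if "k \<le> n" "0 \<le> s" "s \<le> t" "t \<le> real k" for k s t
    using that
  proof (induction k arbitrary: t)
    case 0
    then have "s = 0" "t = 0" by auto
    then show ?case using path_of_length.refl[OF pts[of 0]] by simp
  next
    case (Suc k)
    \<comment> \<open>A piece that straddles the integer \<open>k\<close> is cut there.\<close>
    consider "t \<le> real k" | "real k \<le> s" | "s < real k" "real k < t" by linarith
    then show ?case
    proof cases
      case 3
      have "path_of_length G (g s) (g (real k)) (real k - s)" using 3 Suc by auto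
      moreover have "path_of_length G (g (real k)) (g t) (t - real k)"
        using 3 Suc.prems by (intro seg[of k]) auto
      ultimately have "path_of_length G (g s) (g t) (real k - s + (t - real k))"
        by (intro path_trans)
      then show ?thesis by simp
    next
      case 2
      then show ?thesis using Suc.prems by (intro seg[of k]) auto
    qed (use Suc in auto)
  qed
  have le: "graph_dist G (g s) (g t) \<le> t - s" if "0 \<le> s" "s \<le> t" "t \<le> real n" for s t
    using graph_dist_le path[of n s t] that by blast
  have g0: "g 0 = vertex u" using g_nat[of 0] w by simp
  have gn: "g (real n) = vertex v" using g_nat[of n] w by simp
  have eq: "graph_dist G (g s) (g t) = t - s" if st: "0 \<le> s" "s \<le> t" "t \<le> real n" for s t
  proof -
    \<comment> \<open>The three pieces have distances at most their parameter lengths, but must add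
      up to at least \<open>n\<close>; hence each is exact.\<close>
    have "graph_dist G (g 0) (g (real n)) \<le>
        graph_dist G (g 0) (g s) + (graph_dist G (g s) (g t) + graph_dist G (g t) (g (real n)))"
      using st pts by (intro order_trans[OF triangle[of _ "g s"]] add_mono order_refl triangle) auto
    moreover have "graph_dist G (g 0) (g (real n)) = real n" using n(2) g0 gn by (simp add: vdist_def)
    ultimately show ?thesis using le[of 0 s] le[of t "real n"] le[OF st] st by linarith
  qed
  have "\<bar>s - t\<bar> = graph_dist G (g s) (g t)" if "s \<in> {0..real n}" "t \<in> {0..real n}" for s t
    using eq[of s t] eq[of t s] that commute[of "g s" "g t"] by (cases "s \<le> t") auto
  then have "geodesic (vertex u) (vertex v) (g ` {0..real n})"
    unfolding geodesic_def using n(2) g0 gn pts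
    by (intro exI[of _ g]) (auto simp: vdist_def)
  then show ?thesis by blast
qed

lemma vdist_Metric_space:
  assumes "simple_graph G" "connected_graph G"
  shows "Metric_space (verts G) (vdist G)"
proof -
  interpret Metric_space "points G" "graph_dist G" by (rule Metric_space_graph[OF assms])
  have "vertex u = vertex v \<longleftrightarrow> u = v" for u v :: 'a
  proof
    assume "vertex u = vertex v"
    then have "vertex u u = vertex v u" by simp
    then show "u = v" by (simp add: edge_point_def split: if_splits)
  qed simp
  then show ?thesis
    by unfold_locales (auto simp: vdist_def commute vertex_in_points intro: triangle)
qed

section \<open>Hyperbolicity in terms of vertices\<close>

lemma near_vertex:
  assumes "simple_graph G" "p \<in> points G"
  obtains v where "v \<in> verts G" "graph_dist G p (vertex v) \<le> 1"
proof -
  consider v where "v \<in> verts G" "p = vertex v"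
    | u v t where "{u, v} \<in> edges G" "t \<in> {0..1}" "p = edge_point u v t"
    using assms by (auto simp: points_def)
  then show ?thesis
  proof cases
    case 1
    then show ?thesis
      using that graph_dist_le[OF path_of_length.refl[OF assms(2)]] by force
  next
    case 2
    have "path_of_length G p (vertex u) \<bar>t - 0\<bar>"
      unfolding edge_point_ends(1)[of u v, symmetric] 2(3) by (rule path_segment) (use 2 in auto)
    then show ?thesis using graph_dist_le[of G p "vertex u" t] 2 that simple_edgeD[OF assms(1) 2(1)]
      by auto
  qed
qed

text \<open>Thin triangles give the condition on vertices, where geodesics are available.
  Conversely, moving every point to a vertex within distance 1 is a rough isometry, so the condition
  passes from vertices to all points and gives thinness there.\<close>

lemma hyperbolic_graph_iff_four_point:
  assumes G: "simple_graph G" "connected_graph G"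
  shows "hyperbolic_graph G \<longleftrightarrow> (\<exists>k\<ge>0. four_point (vdist G) (verts G) k)"
proof
  interpret Metric_space "points G" "graph_dist G" by (rule Metric_space_graph[OF G])
  {
    assume "hyperbolic_graph G"
    then obtain \<delta> where \<delta>: "0 \<le> \<delta>" "hyperbolic_const \<delta>"
      by (auto simp: hyperbolic_graph_def hyperbolic_def)
    have "four_point (graph_dist G) (vertex ` verts G) (6 * \<delta> + 2)"
      using vertices_geodesic[OF G]
      by (intro hyperbolic_imp_four_point[OF \<delta>(2,1)]) (auto simp: vertex_in_points)
    then have "four_point (vdist G) (verts G) (6 * \<delta> + 2)"
      by (auto simp: four_point_def vdist_def)
    then show "\<exists>k\<ge>0. four_point (vdist G) (verts G) k"
      using \<delta>(1) by (intro exI[of _ "6 * \<delta> + 2"]) auto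
  }
  {
    assume "\<exists>k\<ge>0. four_point (vdist G) (verts G) k"
    then obtain k where k: "0 \<le> k" "four_point (vdist G) (verts G) k" by blast
    obtain f where f: "\<And>p. p \<in> points G \<Longrightarrow> f p \<in> verts G"
        "\<And>p. p \<in> points G \<Longrightarrow> graph_dist G p (vertex (f p)) \<le> 1"
    proof -
      have "\<forall>p\<in>points G. \<exists>v. v \<in> verts G \<and> graph_dist G p (vertex v) \<le> 1"
        using near_vertex[OF G(1)] by blast
      from bchoice[OF this] show ?thesis using that by blast
    qed
    \<comment> \<open>The 2 counts one displacement of at most 1 for each of \<open>p\<close> and
      \<open>q\<close>.\<close>
    have "\<bar>graph_dist G p q - vdist G (f p) (f q)\<bar> \<le> 2" if pq: "p \<in> points G" "q \<in> points G" for p q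
    proof -
      let ?p = "vertex (f p)" and ?q = "vertex (f q)"
      have pq': "?p \<in> points G" "?q \<in> points G" using f(1) pq by (auto simp: vertex_in_points)
      have "graph_dist G p q \<le> graph_dist G p ?p + graph_dist G ?p ?q + graph_dist G q ?q"
        using triangle[of p ?p q] triangle[of ?p ?q q] pq pq' by (simp add: commute)
      moreover have "graph_dist G ?p ?q \<le> graph_dist G p ?p + graph_dist G p q + graph_dist G q ?q"
        using triangle[of ?p p ?q] triangle[of p q ?q] pq pq' by (simp add: commute)
      ultimately show ?thesis using f(2)[OF pq(1)] f(2)[OF pq(2)] by (auto simp: vdist_def)
    qed
    from four_point_rough_isometry[where f = f, OF k(2) f(1) this]
    have "four_point (graph_dist G) (points G) (k + 4 * 2)" by blast
    then have "hyperbolic_const (2 * (k + 4 * 2))"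
      using k(1) by (intro four_point_imp_hyperbolic) auto
    then show "hyperbolic_graph G"
      unfolding hyperbolic_graph_def hyperbolic_def using k(1)
      by (intro exI[of _ "2 * (k + 4 * 2)"]) auto
  }
qed

text \<open>The four-point condition is pulled back along \<open>f\<close> in one direction and
  along a right inverse of \<open>f\<close> on \<open>verts H\<close> in the other. In this form it
  covers the merging map, which is onto but not injective.\<close>

lemma hyperbolic_graph_rough_isometry:
  assumes G: "simple_graph G" "connected_graph G" and H: "simple_graph H" "connected_graph H"
    and f: "f ` verts G = verts H"
    and rough: "\<And>u v. u \<in> verts G \<Longrightarrow> v \<in> verts G \<Longrightarrow> \<bar>vdist G u v - vdist H (f u) (f v)\<bar> \<le> C"
  shows "hyperbolic_graph G \<longleftrightarrow> hyperbolic_graph H"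
proof -
  obtain v where "v \<in> verts G" using G by (auto simp: connected_graph_def)
  then have C: "0 \<le> C" using rough[of v v] by linarith
  have "\<exists>k\<ge>0. four_point (vdist G) (verts G) k" if "0 \<le> k" "four_point (vdist H) (verts H) k" for k
  proof -
    have "four_point (vdist G) (verts G) (k + 4 * C)"
      using four_point_rough_isometry[where f = f, OF that(2) _ rough] f by blast
    then show ?thesis using that C by (intro exI[of _ "k + 4 * C"]) auto
  qed
  moreover have "\<exists>k\<ge>0. four_point (vdist H) (verts H) k"
    if "0 \<le> k" "four_point (vdist G) (verts G) k" for k
  proof -
    define g where "g = inv_into (verts G) f"
    have g: "g x \<in> verts G" "f (g x) = x" if "x \<in> verts H" for x
      using that f inv_into_into[of x f "verts G"] f_inv_into_f[of x f "verts G"]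
      by (auto simp: g_def)
    have "\<bar>vdist H x y - vdist G (g x) (g y)\<bar> \<le> C" if "x \<in> verts H" "y \<in> verts H" for x y
      using rough[of "g x" "g y"] g that by (simp add: abs_minus_commute)
    from four_point_rough_isometry[where f = g, OF that(2) g(1) this]
    have "four_point (vdist H) (verts H) (k + 4 * C)" by blast
    then show ?thesis using that C by (intro exI[of _ "k + 4 * C"]) auto
  qed
  ultimately show ?thesis
    unfolding hyperbolic_graph_iff_four_point[OF G] hyperbolic_graph_iff_four_point[OF H] by blast
qed

section \<open>Removing and contracting an edge\<close>

lemma vdist_edge:
  assumes "simple_graph G" "{a, b} \<in> edges G"
  shows "vdist G a b \<le> 1"
  using vdist_le_walk[of a G b 1] simple_edgeD[OF assms] assms by simp

section \<open>Removing an edge\<close>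

lemma simple_graph_remove: "simple_graph G \<Longrightarrow> simple_graph (remove_edge G e)"
  by (auto simp: simple_graph_def remove_edge_def)

lemma connected_graph_remove:
  assumes "connected_graph (remove_edge G e)"
  shows "connected_graph G"
proof -
  have "(adj (remove_edge G e))\<^sup>* \<subseteq> (adj G)\<^sup>*"
    by (rule rtrancl_mono) (auto simp: remove_edge_def)
  then show ?thesis using assms by (auto simp: connected_graph_def remove_edge_def)
qed

lemma hyperbolic_graph_remove:
  assumes G: "simple_graph G" and e: "e \<in> edges G" and H: "connected_graph (remove_edge G e)"
  shows "hyperbolic_graph G \<longleftrightarrow> hyperbolic_graph (remove_edge G e)"
proof -
  let ?H = "remove_edge G e" and ?d = "vdist (remove_edge G e)"
  note conn = connected_graph_remove[OF H] and simp_H = simple_graph_remove[OF G, of e]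
  interpret H: Metric_space "verts ?H" ?d by (rule vdist_Metric_space[OF simp_H H])
  obtain A B where AB: "e = {A, B}" "A \<noteq> B" "A \<in> verts G" "B \<in> verts G"
    using simple_edge_cases[OF G e] .
  have V: "verts ?H = verts G" by (simp add: remove_edge_def)
  \<comment> \<open>A walk in \<open>G\<close> either has a replacement avoiding \<open>e\<close>,
    or amounts to a single passage of \<open>e\<close>, counted as 1, in one of the two
    directions.\<close>
  have key: "?d u v \<le> real n \<or> ?d u A + 1 + ?d B v \<le> real n \<or> ?d u B + 1 + ?d A v \<le> real n"
    if u: "u \<in> verts G" and "v \<in> verts G" "(u, v) \<in> adj G ^^ n" for u v n
    using that(2,3)
  proof (induction n arbitrary: v)
    case 0
    then show ?case using V by simp
  next
    case (Suc n)
    then obtain x where x: "(u, x) \<in> adj G ^^ n" "{x, v} \<in> edges G" by auto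
    note xG = simple_edgeD[OF G x(2)]
    note IH = Suc.IH[OF xG(1) x(1)]
    show ?case
    proof (cases "{x, v} = e")
      case True
      then have "x = A \<and> v = B \<or> x = B \<and> v = A" using AB by (auto simp: doubleton_eq_iff)
      then show ?thesis
        using IH V AB H.nonneg[of A B] H.nonneg[of B A] H.mdist_zero[of A] H.mdist_zero[of B] by auto
    next
      case False
      then have "?d x v \<le> 1" using vdist_edge[OF simp_H, of x v] x by (auto simp: remove_edge_def)
      moreover have "?d y v \<le> ?d y x + ?d x v" if "y \<in> verts G" for y
        using H.triangle that xG V by blast
      from this[OF u] this[OF AB(3)] this[OF AB(4)]
      have "?d u v \<le> ?d u x + ?d x v" "?d A v \<le> ?d A x + ?d x v" "?d B v \<le> ?d B x + ?d x v" .
      ultimately show ?thesis using IH by auto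
    qed
  qed
  \<comment> \<open>The constant \<open>?d A B\<close> is the length of a detour around
    \<open>e\<close>; connectedness of the smaller graph guarantees that such a detour
    exists.\<close>
  have "\<bar>vdist G u v - ?d u v\<bar> \<le> ?d A B" if uv: "u \<in> verts G" "v \<in> verts G" for u v
  proof -
    obtain n where n: "(u, v) \<in> adj ?H ^^ n" "?d u v = real n"
      using vdist_walk[OF simp_H H] uv V by metis
    have "(u, w) \<in> adj ?H ^^ m \<Longrightarrow> (u, w) \<in> adj G ^^ m" for w m
      by (induction m arbitrary: w) (auto simp: remove_edge_def)
    from this[OF n(1)] have "(u, v) \<in> adj G ^^ n" .
    then have "vdist G u v \<le> ?d u v" using vdist_le_walk[OF uv(1)] n by simp
    moreover obtain m where m: "(u, v) \<in> adj G ^^ m" "vdist G u v = real m"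
      using vdist_walk[OF G conn uv] .
    have H_verts: "u \<in> verts ?H" "v \<in> verts ?H" "A \<in> verts ?H" "B \<in> verts ?H"
      using uv AB V by simp_all
    have "?d u v \<le> ?d u A + ?d A B + ?d B v" "?d u v \<le> ?d u B + ?d A B + ?d A v"
      using H.triangle[OF H_verts(1,3,2)] H.triangle[OF H_verts(3,4,2)]
        H.triangle[OF H_verts(1,4,2)] H.triangle[OF H_verts(4,3,2)] H.commute[of B A]
      by linarith+
    then have "?d u v \<le> vdist G u v + ?d A B"
      using key[OF uv m(1)] m(2) H.nonneg[of A B] by linarith
    ultimately show ?thesis using H.nonneg[of A B] by linarith
  qed
  then show ?thesis
    using V by (intro hyperbolic_graph_rough_isometry[OF G conn simp_H H, of "\<lambda>v. v" "?d A B"]) auto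
qed

section \<open>Contracting an edge\<close>

text \<open>The condition on \<open>c\<close> keeps it distinct from every vertex outside
  \<open>e\<close>, so merging identifies the endpoints of \<open>e\<close> and nothing
  else.\<close>

lemma merge_eq_iff:
  assumes "c \<notin> V - e" "x \<in> V" "y \<in> V"
  shows "merge e c x = merge e c y \<longleftrightarrow> x = y \<or> x \<in> e \<and> y \<in> e"
  using assms by (auto simp: merge_def)

lemma simple_graph_contract:
  assumes G: "simple_graph G" and e: "e \<in> edges G" and c: "c \<notin> verts G - e"
  shows "simple_graph (contract_edge G e c)"
  unfolding simple_graph_def
proof
  fix h assume "h \<in> edges (contract_edge G e c)"
  then obtain f where f: "f \<in> edges G" "f \<noteq> e" "h = merge e c ` f"
    by (auto simp: contract_edge_def)
  obtain a b where ab: "f = {a, b}" "a \<noteq> b" "a \<in> verts G" "b \<in> verts G"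
    using simple_edge_cases[OF G f(1)] .
  obtain A B where "e = {A, B}" "A \<noteq> B" using simple_edge_cases[OF G e] .
  \<comment> \<open>An edge with both endpoints in \<open>e\<close> would be \<open>e\<close>
    itself.\<close>
  then have "\<not> (a \<in> e \<and> b \<in> e)" using ab f(2) by auto
  then have "merge e c a \<noteq> merge e c b" using merge_eq_iff[OF c ab(3,4)] ab by blast
  then show "h \<subseteq> verts (contract_edge G e c) \<and> card h = 2"
    using ab f(3) by (auto simp: contract_edge_def)
qed

text \<open>Edges lift one at a time; lifts of consecutive edges may end and start at different
  endpoints of \<open>e\<close>, a gap that later arguments must bridge.\<close>

lemma contract_adjE:
  assumes "simple_graph G" "(y, y') \<in> adj (contract_edge G e c)"
  obtains x x' where "{x, x'} \<in> edges G" "y = merge e c x" "y' = merge e c x'"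
proof -
  obtain f where f: "f \<in> edges G" "{y, y'} = merge e c ` f"
    using assms(2) by (auto simp: contract_edge_def)
  obtain a b where ab: "f = {a, b}" using simple_edge_cases[OF assms(1) f(1)] .
  then have "{y, y'} = {merge e c a, merge e c b}" using f by simp
  then consider "y = merge e c a" "y' = merge e c b" | "y = merge e c b" "y' = merge e c a"
    by (auto simp: doubleton_eq_iff)
  then show ?thesis
    using that[of a b] that[of b a] f ab by cases (auto simp: insert_commute)
qed

lemma connected_graph_contract:
  assumes G: "simple_graph G" and e: "e \<in> edges G" and c: "c \<notin> verts G - e"
    and H: "connected_graph (contract_edge G e c)"
  shows "connected_graph G"
  unfolding connected_graph_def
proof (intro conjI ballI)
  show "verts G \<noteq> {}" using H by (auto simp: connected_graph_def contract_edge_def)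
  obtain A B where AB: "e = {A, B}" using simple_edge_cases[OF G e] .
  \<comment> \<open>The gap between two preimages of one vertex is bridged by
    \<open>e\<close>.\<close>
  have eq: "(x, y) \<in> (adj G)\<^sup>*"
    if "merge e c x = merge e c y" "x \<in> verts G" "y \<in> verts G" for x y
  proof -
    have "x = y \<or> {x, y} = e" using that merge_eq_iff[OF c] AB by auto
    then show ?thesis using e by auto
  qed
  fix u v assume uv: "u \<in> verts G" "v \<in> verts G"
  \<comment> \<open>Quantifying over all preimages \<open>v\<close> of \<open>y\<close> lets the
    induction hypothesis be used at the preimage where the next lifted edge starts.\<close>
  have "(u, v) \<in> (adj G)\<^sup>*"
    if "(merge e c u, y) \<in> (adj (contract_edge G e c))\<^sup>*" "merge e c v = y" "v \<in> verts G" for y v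
    using that
  proof (induction arbitrary: v rule: rtrancl_induct)
    case base
    then show ?case using eq uv by metis
  next
    case (step y z)
    obtain x x' where x: "{x, x'} \<in> edges G" "y = merge e c x" "z = merge e c x'"
      using contract_adjE[OF G step.hyps(2)] .
    note xG = simple_edgeD[OF G x(1)]
    have "(u, x) \<in> (adj G)\<^sup>*" using step.IH x xG by auto
    then have "(u, x') \<in> (adj G)\<^sup>*" using x by (auto intro: rtrancl_into_rtrancl)
    also have "(x', v) \<in> (adj G)\<^sup>*" using eq x xG step.prems by auto
    finally show ?case .
  qed
  then show "(u, v) \<in> (adj G)\<^sup>*" using H uv by (auto simp: connected_graph_def contract_edge_def)
qed

lemma hyperbolic_graph_contract:
  assumes G: "simple_graph G" and e: "e \<in> edges G" and c: "c \<notin> verts G - e"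
    and H: "connected_graph (contract_edge G e c)"
  shows "hyperbolic_graph G \<longleftrightarrow> hyperbolic_graph (contract_edge G e c)"
proof -
  let ?H = "contract_edge G e c" and ?f = "merge e c" and ?d = "vdist G"
  note conn = connected_graph_contract[OF assms] and simp_H = simple_graph_contract[OF G e c]
  interpret G: Metric_space "verts G" ?d by (rule vdist_Metric_space[OF G conn])
  interpret H: Metric_space "verts ?H" "vdist ?H" by (rule vdist_Metric_space[OF simp_H H])
  obtain A B where AB: "e = {A, B}" "A \<noteq> B" "A \<in> verts G" "B \<in> verts G"
    using simple_edge_cases[OF G e] .
  have V: "verts ?H = ?f ` verts G" by (simp add: contract_edge_def)
  \<comment> \<open>Merging does not increase distances: every edge maps to an edge, except
    \<open>e\<close>, which collapses to a vertex.\<close>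
  have le: "vdist ?H (?f u) (?f v) \<le> real n"
    if u: "u \<in> verts G" and "(u, v) \<in> adj G ^^ n" for u v n
    using that(2)
  proof (induction n arbitrary: v)
    case 0
    then show ?case using u V by simp
  next
    case (Suc n)
    then obtain x where x: "(u, x) \<in> adj G ^^ n" "{x, v} \<in> edges G" by auto
    note xG = simple_edgeD[OF G x(2)]
    have "vdist ?H (?f x) (?f v) \<le> 1"
    proof (cases "{x, v} = e")
      case True
      then have "?f x = ?f v" by (auto simp: merge_def)
      then show ?thesis using xG V by simp
    next
      case False
      then have "?f ` {x, v} \<in> edges ?H" using x(2) by (auto simp only: contract_edge_def sgraph.simps)
      then have "{?f x, ?f v} \<in> edges ?H" by simp
      then show ?thesis by (rule vdist_edge[OF simp_H])
    qed
    moreover have "vdist ?H (?f u) (?f v) \<le> vdist ?H (?f u) (?f x) + vdist ?H (?f x) (?f v)"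
      using u xG V by (intro H.triangle) auto
    ultimately show ?case using Suc.IH[OF x(1)] by simp
  qed
  \<comment> \<open>A walk in the contracted graph either lifts without gaps, or reaches
    \<open>e\<close> at \<open>a\<close> and leaves it at \<open>b\<close>, the jump from
    \<open>a\<close> to \<open>b\<close> being free.\<close>
  have key: "?d u v \<le> real n \<or> (\<exists>a\<in>e. \<exists>b\<in>e. ?d u a + ?d b v \<le> real n)"
    if u: "u \<in> verts G" and "v \<in> verts G" "(?f u, ?f v) \<in> adj ?H ^^ n" for u v n
    using that(2,3)
  proof (induction n arbitrary: v)
    case 0
    then have "u = v \<or> u \<in> e \<and> v \<in> e" using merge_eq_iff[OF c u, of v] by simp
    then show ?case using u 0 by (force simp: G.mdist_zero)
  next
    case (Suc n)
    then obtain y where y: "(?f u, y) \<in> adj ?H ^^ n" "(y, ?f v) \<in> adj ?H" by auto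
    obtain x x' where x: "{x, x'} \<in> edges G" "y = ?f x" "?f v = ?f x'"
      using contract_adjE[OF G y(2)] .
    note xG = simple_edgeD[OF G x(1)]
    have step: "?d w x' \<le> ?d w x + 1" if "w \<in> verts G" for w
      using G.triangle[OF that xG(1,2)] vdist_edge[OF G x(1)] by linarith
    have "?d u x \<le> real n \<or> (\<exists>a\<in>e. \<exists>b\<in>e. ?d u a + ?d b x \<le> real n)"
      using Suc.IH[OF xG(1)] y x by auto
    then have x': "?d u x' \<le> real (Suc n) \<or> (\<exists>a\<in>e. \<exists>b\<in>e. ?d u a + ?d b x' \<le> real (Suc n))"
    proof
      assume "?d u x \<le> real n"
      then show ?thesis using step[OF u] by auto
    next
      assume "\<exists>a\<in>e. \<exists>b\<in>e. ?d u a + ?d b x \<le> real n"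
      then obtain a b where ab: "a \<in> e" "b \<in> e" "?d u a + ?d b x \<le> real n" by blast
      then have "?d u a + ?d b x' \<le> real (Suc n)" using step[of b] AB by auto
      then show ?thesis using ab by blast
    qed
    have "v = x' \<or> v \<in> e \<and> x' \<in> e" using merge_eq_iff[OF c Suc.prems(1) xG(2)] x(3) by simp
    then show ?case
    proof
      assume ve: "v \<in> e \<and> x' \<in> e"
      have "\<exists>a\<in>e. ?d u a \<le> real (Suc n)"
        using x'
      proof
        assume "\<exists>a\<in>e. \<exists>b\<in>e. ?d u a + ?d b x' \<le> real (Suc n)"
        then obtain a b where "a \<in> e" "?d u a + ?d b x' \<le> real (Suc n)" by blast
        moreover have "0 \<le> ?d b x'" by simp
        ultimately have "?d u a \<le> real (Suc n)" by linarith
        then show ?thesis using \<open>a \<in> e\<close> by blast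
      qed (use ve in blast)
      moreover have "?d v v = 0" using Suc.prems(1) by simp
      ultimately show ?thesis using ve by (metis add.right_neutral)
    qed (use x' in simp)
  qed
  \<comment> \<open>The constant 1 pays for the free jump, since endpoints of \<open>e\<close> are
    at distance at most 1.\<close>
  have "\<bar>?d u v - vdist ?H (?f u) (?f v)\<bar> \<le> 1" if uv: "u \<in> verts G" "v \<in> verts G" for u v
  proof -
    have f: "?f u \<in> verts ?H" "?f v \<in> verts ?H" using uv V by auto
    obtain n where n: "(?f u, ?f v) \<in> adj ?H ^^ n" "vdist ?H (?f u) (?f v) = real n"
      using vdist_walk[OF simp_H H f] .
    obtain m where m: "(u, v) \<in> adj G ^^ m" "?d u v = real m"
      using vdist_walk[OF G conn uv] .
    have ab: "?d a b \<le> 1" "a \<in> verts G" "b \<in> verts G" if "a \<in> e" "b \<in> e" for a b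
      using that AB e vdist_edge[OF G, of A B] by (auto simp: G.commute)
    have "?d u v \<le> real n + 1"
      using key[OF uv n(1)]
    proof
      assume "\<exists>a\<in>e. \<exists>b\<in>e. ?d u a + ?d b v \<le> real n"
      then obtain a b where "a \<in> e" "b \<in> e" "?d u a + ?d b v \<le> real n" by blast
      then show ?thesis
        using G.triangle[of u a v] G.triangle[of a b v] ab[of a b] uv by auto
    qed simp
    then show ?thesis using le[OF uv(1) m(1)] m(2) n(2) by auto
  qed
  then show ?thesis
    using V by (intro hyperbolic_graph_rough_isometry[OF G conn simp_H H, of ?f 1]) auto
qed

section \<open>Sequences of removals and contractions\<close>

lemma edge_step_simple: "edge_step G H \<Longrightarrow> simple_graph G \<Longrightarrow> simple_graph H"
  by (induction rule: edge_step.induct) (auto intro: simple_graph_remove simple_graph_contract)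

lemma edge_step_connected:
  "edge_step G H \<Longrightarrow> simple_graph G \<Longrightarrow> connected_graph H \<Longrightarrow> connected_graph G"
  by (induction rule: edge_step.induct) (auto dest: connected_graph_remove connected_graph_contract)

lemma edge_step_hyperbolic:
  "edge_step G H \<Longrightarrow> simple_graph G \<Longrightarrow> connected_graph H \<Longrightarrow>
    hyperbolic_graph G \<longleftrightarrow> hyperbolic_graph H"
  by (induction rule: edge_step.induct)
    (auto simp: hyperbolic_graph_remove hyperbolic_graph_contract)

theorem theorem3p4:
  fixes G G' :: "'a sgraph"
  assumes "simple_graph G" "connected_graph G"
    and "edge_step\<^sup>*\<^sup>* G G'" "connected_graph G'"
  shows "hyperbolic_graph G \<longleftrightarrow> hyperbolic_graph G'"
proof -
  \<comment> \<open>Simplicity passes forward along the steps and connectedness backward from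
    \<open>G'\<close>. Hence the former is a premise and the latter part of the conclusion, in an
    induction that peels off the first step.\<close>
  have "simple_graph G \<longrightarrow> connected_graph G \<and> (hyperbolic_graph G \<longleftrightarrow> hyperbolic_graph G')"
    using assms(3)
  proof (induction rule: converse_rtranclp_induct)
    case base
    then show ?case using assms(4) by simp
  next
    case (step G H)
    then show ?case
      using edge_step_simple edge_step_connected edge_step_hyperbolic by blast
  qed
  then show ?thesis using assms(1) by simp
qed

end
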